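(* Let $n\in\mathbb{N}$ and, for each $i=1,\ldots,n$, let $\lambda_i^-,\lambda_i^+:\mathbb{N}\to\mathbb{R}$ be sequences such that for each $m\in\mathbb{N}$ and $1\le i\le n$, $$(1*\lambda_i^-)(m)\le(1*\mu)(m)\le(1*\lambda_i^+)(m).$$ Then for each $\mathbf m=(m_1,\ldots,m_n)\in\mathbb{N}^n$, $$\prod_{i=1}^n(1*\mu)(m_i)\ \ge\ \sum_{i=1}^n(1*\lambda_i^-)(m_i)\prod_{\substack{1\le j\le n \\ j\ne i}}(1*\lambda_j^+)(m_j)-(n-1)\prod_{i=1}^n(1*\lambda_i^+)(m_i).$$
   Context: $\mu$ is the Möbius function and $*$ denotes Dirichlet convolution: $(1*\lambda)(m)=\sum_{k\mid m}\lambda(k)$. *)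

theory Defs
  imports Complex_Main "HOL-Computational_Algebra.Squarefree"
begin

(* Arithmetic functions are meant on the positive integers. Their value at 0 is junk, and it
   does not enter a convolution at a positive argument, whose divisors are positive. *)

definition moebius_mu :: "nat \<Rightarrow> real" where
  "moebius_mu n = (if squarefree n then (-1) ^ card (prime_factors n) else 0)"

definition dirichlet_conv :: "(nat \<Rightarrow> real) \<Rightarrow> (nat \<Rightarrow> real) \<Rightarrow> nat \<Rightarrow> real" where
  "dirichlet_conv f g m = (\<Sum>k | k dvd m. f (m div k) * g k)"

abbreviation one_conv :: "(nat \<Rightarrow> real) \<Rightarrow> nat \<Rightarrow> real" where
  "one_conv g \<equiv> dirichlet_conv (\<lambda>_. 1) g"

end

theory Submission
  imports Defs
begin

text \<open>
  The product inequality holds for arbitrary reals with \<open>0 \<le> x\<^sub>i \<le> b\<^sub>i\<close> and \<open>a\<^sub>i \<le> x\<^sub>i\<close>: the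
  coefficient of \<open>a\<^sub>i\<close> is nonnegative, so one may take \<open>a\<^sub>i = x\<^sub>i\<close>, and adding a factor \<open>k\<close> then
  costs \<open>(b\<^sub>k - x\<^sub>k) (\<Prod>b - \<Prod>x) \<ge> 0\<close>. It applies because \<open>1 * \<mu>\<close> is the indicator function
  of \<open>1\<close>, hence nonnegative.
\<close>

lemma prime_factors_Prod_primes:
  fixes S :: "nat set"
  assumes "finite S" "\<And>p. p \<in> S \<Longrightarrow> prime p"
  shows "prime_factors (\<Prod>S) = S"
proof -
  have "0 \<notin> S"
    using assms(2) not_prime_0 by blast
  then have "\<Prod>S \<noteq> 0"
    using assms(1) by simp
  then have "prime_factors (\<Prod>S) = {p. prime p \<and> p dvd \<Prod>S}"
    by (auto simp: prime_factors_dvd)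
  also have "\<dots> = S"
    \<comment> \<open>A prime dividing a product of primes divides one of them, hence equals
      it.\<close>
    using assms by (auto simp: prime_dvd_prod_iff) (metis primes_dvd_imp_eq)
  finally show ?thesis .
qed

lemma squarefree_Prod_primes:
  fixes S :: "nat set"
  assumes "\<And>p. p \<in> S \<Longrightarrow> prime p"
  shows "squarefree (\<Prod>S)"
  using assms by (intro squarefree_prod_coprime) (auto simp: primes_coprime squarefree_prime)

lemma Prod_prime_factors_squarefree:
  fixes k :: nat
  assumes "squarefree k"
  shows "\<Prod>(prime_factors k) = k"
proof -
  have "k \<noteq> 0"
    using assms by (metis not_squarefree_0)
  then have "k = (\<Prod>p\<in>prime_factors k. p ^ multiplicity p k)"
    by (simp flip: prime_factorization_nat)
  also have "\<dots> = \<Prod>(prime_factors k)"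
    using assms \<open>k \<noteq> 0\<close> by (intro prod.cong) (auto simp: squarefree_factorial_semiring')
  finally show ?thesis ..
qed

text \<open>\<open>prime_factors\<close> and \<open>Prod\<close> are mutually inverse bijections
  between the squarefree divisors of \<open>m\<close> and the sets of primes dividing
  \<open>m\<close>.\<close>

lemma sum_squarefree_divisors:
  fixes m :: nat
  assumes "m > 0"
  shows "(\<Sum>k | k dvd m \<and> squarefree k. f (prime_factors k)) = (\<Sum>S\<in>Pow (prime_factors m). f S)"
proof (rule sum.reindex_bij_witness[of _ Prod prime_factors])
  fix k assume k: "k \<in> {k. k dvd m \<and> squarefree k}"
  then show "\<Prod>(prime_factors k) = k"
    by (simp add: Prod_prime_factors_squarefree)
  show "prime_factors k \<in> Pow (prime_factors m)"
    using k assms by (simp add: dvd_prime_factors)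
next
  fix S assume "S \<in> Pow (prime_factors m)"
  then have S: "S \<subseteq> prime_factors m" "finite S" "\<And>p. p \<in> S \<Longrightarrow> prime p"
    by (auto intro: finite_subset)
  show "prime_factors (\<Prod>S) = S"
    using S by (simp add: prime_factors_Prod_primes)
  have "\<Prod>S dvd \<Prod>(prime_factors m)"
    using S by (intro prod_dvd_prod_subset) auto
  \<comment> \<open>Each prime factor of \<open>m\<close> occurs with exponent at least 1.\<close>
  also have "\<dots> dvd (\<Prod>p\<in>prime_factors m. p ^ multiplicity p m)"
    by (intro prod_dvd_prod dvd_power) (auto simp: prime_factors_multiplicity)
  also have "\<dots> = m"
    using assms by (simp flip: prime_factorization_nat)
  finally show "\<Prod>S \<in> {k. k dvd m \<and> squarefree k}"
    using S by (simp add: squarefree_Prod_primes)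
qed auto

text \<open>Only squarefree divisors contribute, so the sum runs over sets \<open>S\<close> of
  primes dividing \<open>m\<close> with sign \<open>(-1) ^ card S\<close>. This is the expansion of
  the product of \<open>1 - 1\<close> over these primes, which is empty for \<open>m = 1\<close> and
  has a zero factor otherwise.\<close>

lemma one_conv_moebius_mu:
  assumes "m > 0"
  shows "one_conv moebius_mu m = (if m = 1 then 1 else 0)"
proof -
  have "one_conv moebius_mu m =
      (\<Sum>k | k dvd m \<and> squarefree k. (-1) ^ card (prime_factors k))"
    unfolding dirichlet_conv_def moebius_mu_def
    using assms by (intro sum.mono_neutral_cong_right) auto
  also have "\<dots> = (\<Sum>S\<in>Pow (prime_factors m). (-1) ^ card S)"
    using assms by (rule sum_squarefree_divisors)
  also have "\<dots> = (\<Prod>p\<in>prime_factors m. 1 - 1)"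
    by (subst prod_diff_conv_sum) simp_all
  also have "\<dots> = (if m = 1 then 1 else 0)"
    using assms by (auto simp: prime_factorization_empty_iff power_0_left)
  finally show ?thesis .
qed

lemma sum_mult_prod_remove_le:
  fixes x b :: "'a \<Rightarrow> real"
  assumes "finite A" "\<And>i. i \<in> A \<Longrightarrow> 0 \<le> x i \<and> x i \<le> b i"
  shows "(\<Sum>i\<in>A. x i * prod b (A - {i})) \<le> prod x A + (real (card A) - 1) * prod b A"
  using assms
proof (induction A rule: finite_induct)
  case empty
  \<comment> \<open>The subtraction is in the reals: the coefficient is -1, and both sides equal
    0.\<close>
  then show ?case by simp
next
  case (insert k A)
  have IH: "(\<Sum>i\<in>A. x i * prod b (A - {i})) \<le> prod x A + (real (card A) - 1) * prod b A"
    using insert by simp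
  \<comment> \<open>For \<open>i\<close> in \<open>A\<close> the new index contributes a common
    factor \<open>b k\<close>, which leaves the sum of the induction hypothesis. The term for
    \<open>k\<close> itself is \<open>x k * prod b A\<close>.\<close>
  have "(\<Sum>i\<in>A. x i * prod b (insert k A - {i})) = (\<Sum>i\<in>A. b k * (x i * prod b (A - {i})))"
  proof (rule sum.cong)
    fix i assume "i \<in> A"
    then have "insert k A - {i} = insert k (A - {i})"
      using insert.hyps by auto
    then show "x i * prod b (insert k A - {i}) = b k * (x i * prod b (A - {i}))"
      using insert.hyps by simp
  qed simp
  then have "(\<Sum>i\<in>insert k A. x i * prod b (insert k A - {i})) =
      x k * prod b A + b k * (\<Sum>i\<in>A. x i * prod b (A - {i}))"
    using insert.hyps by (simp add: sum_distrib_left)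
  also have "\<dots> \<le> x k * prod b A + b k * (prod x A + (real (card A) - 1) * prod b A)"
    using IH insert.prems[of k] by (intro add_left_mono mult_left_mono) auto
  also have "\<dots> \<le> x k * prod x A + real (card A) * (b k * prod b A)"
  proof -
    have "prod x A \<le> prod b A"
      using insert.prems by (intro prod_mono) auto
    \<comment> \<open>Expanded, this product is exactly the right side minus the left side.\<close>
    then have "0 \<le> (b k - x k) * (prod b A - prod x A)"
      using insert.prems[of k] by (intro mult_nonneg_nonneg) auto
    then show ?thesis
      by (simp add: algebra_simps)
  qed
  finally show ?case
    using insert.hyps by simp
qed

theorem lemma5p1:
  fixes n :: nat
    and lam_minus lam_plus :: "nat \<Rightarrow> nat \<Rightarrow> real"
    and m :: "nat \<Rightarrow> nat"
  assumes "n \<ge> 1"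
    and "\<And>i k. i \<in> {1..n} \<Longrightarrow> k \<ge> 1 \<Longrightarrow>
           one_conv (lam_minus i) k \<le> one_conv moebius_mu k \<and>
           one_conv moebius_mu k \<le> one_conv (lam_plus i) k"
    and "\<And>i. i \<in> {1..n} \<Longrightarrow> m i \<ge> 1"
  shows "(\<Prod>i\<in>{1..n}. one_conv moebius_mu (m i)) \<ge>
         (\<Sum>i\<in>{1..n}. one_conv (lam_minus i) (m i) *
            (\<Prod>j\<in>{1..n} - {i}. one_conv (lam_plus j) (m j))) -
         (real n - 1) * (\<Prod>i\<in>{1..n}. one_conv (lam_plus i) (m i))"
proof -
  define a where "a i = one_conv (lam_minus i) (m i)" for i
  define b where "b i = one_conv (lam_plus i) (m i)" for i
  define x where "x i = one_conv moebius_mu (m i)" for i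
  have bounds: "a i \<le> x i" "0 \<le> x i" "x i \<le> b i" if "i \<in> {1..n}" for i
  proof -
    show "a i \<le> x i" "x i \<le> b i"
      using assms(2,3) that by (simp_all add: a_def b_def x_def)
    show "0 \<le> x i"
      using assms(3)[OF that] by (simp add: x_def one_conv_moebius_mu)
  qed
  have "(\<Sum>i\<in>{1..n}. a i * prod b ({1..n} - {i})) \<le> (\<Sum>i\<in>{1..n}. x i * prod b ({1..n} - {i}))"
    \<comment> \<open>The products of \<open>b\<close> are nonnegative because 0 \<le>
      \<open>x j\<close> \<le> \<open>b j\<close>.\<close>
    using bounds by (intro sum_mono mult_right_mono prod_nonneg) (auto intro: order_trans)
  also have "\<dots> \<le> prod x {1..n} + (real n - 1) * prod b {1..n}"
    using sum_mult_prod_remove_le[of "{1..n}" x b] bounds by simp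
  finally show ?thesis
    by (simp add: a_def b_def x_def)
qed

end
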